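(* Let $q=3^d$ with $d$ even, and consider an elliptic curve $E\colon y^2=x^3+a_4x+b$ over $\mathbb{F}_q$ (with $a_4, b\in\mathbb{F}_q$) such that $-a_4=\gamma^2$ for some $\gamma\in\mathbb{F}_q^\times$ which is not a square in $\mathbb{F}_q^\times$. Then \[\#E(\mathbb{F}_q)=\begin{cases} q+1+(-1)^{\frac d2}\,2\sqrt q & \text{if } \operatorname{Tr}(b\gamma^{-3})=0,\\ q+1-(-1)^{\frac d2}\sqrt q & \text{if } \operatorname{Tr}(b\gamma^{-3})=\pm1. \end{cases}\]
   Context: $\operatorname{Tr}$ denotes the trace map $\mathbb{F}_q\to\mathbb{F}_3$, with $\mathbb{F}_3=\{0,1,-1\}$. $\#E(\mathbb{F}_q)$ counts all $\mathbb{F}_q$-rational points, including the point at infinity. *)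

theory Defs
  imports Complex_Main "HOL-Number_Theory.Number_Theory"
begin

text \<open>
  The trace from a field with \<open>3 ^ d\<close> elements to its prime field, as the sum of the Galois
  conjugates. Its values lie in the copy \<open>{0, 1, -1}\<close> of the prime field inside \<open>'a\<close>;
  see \<open>trace_F3_in_prime_field\<close> below.
\<close>
definition trace_F3 :: "nat \<Rightarrow> 'a::finite_field \<Rightarrow> 'a" where
  "trace_F3 d x = (\<Sum>i<d. x ^ (3 ^ i))"

datatype 'a curve_point = Infinity | Affine 'a 'a

definition weierstrass_points :: "'a::field \<Rightarrow> 'a \<Rightarrow> 'a curve_point set" where
  "weierstrass_points a b =
     insert Infinity {Affine x y | x y. y ^ 2 = x ^ 3 + a * x + b}"

text \<open>
  Nonvanishing of the discriminant of \<open>y\<^sup>2 = x\<^sup>3 + a x + b\<close>. In characteristic other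
  than 2 this is smoothness of the curve; in characteristic 3 it reduces to \<open>a \<noteq> 0\<close>.
\<close>
definition is_elliptic_curve :: "'a::field \<Rightarrow> 'a \<Rightarrow> bool" where
  "is_elliptic_curve a b \<longleftrightarrow> - 16 * (4 * a ^ 3 + 27 * b ^ 2) \<noteq> 0"

lemma CHAR_eq_3:
  assumes "card (UNIV :: 'a::finite_field set) = 3 ^ d"
  shows "CHAR('a) = 3"
proof -
  have "prime CHAR('a)"
    by (rule prime_CHAR_semidom) (simp add: finite_imp_CHAR_pos)
  moreover have "CHAR('a) dvd 3 ^ d"
    using CHAR_dvd_CARD[where ?'a = 'a] assms by simp
  ultimately have "CHAR('a) dvd 3"
    using prime_dvd_power by blast
  then show ?thesis
    using \<open>prime CHAR('a)\<close> primes_dvd_imp_eq[of "CHAR('a)" 3] by simp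
qed

lemma trace_F3_in_prime_field:
  fixes x :: "'a::finite_field"
  assumes card: "card (UNIV :: 'a set) = 3 ^ d"
  shows "trace_F3 d x \<in> {0, 1, -1}"
proof -
  let ?t = "trace_F3 d x"
  have char: "CHAR('a) = 3" using CHAR_eq_3[OF card] .
  have "?t ^ 3 = (\<Sum>i<d. (x ^ (3 ^ i)) ^ 3)"
    unfolding trace_F3_def by (rule freshmans_dream_sum) (simp_all add: char)
  also have "\<dots> = (\<Sum>i<d. x ^ (3 ^ Suc i))"
    by (rule sum.cong) (simp_all only: power_Suc2 power_mult)
  also have "\<dots> = (\<Sum>i<Suc d. x ^ (3 ^ i)) - x"
    by (subst sum.lessThan_Suc_shift) simp
  also have "\<dots> = ?t"
    using finite_field_power_card_eq_same[of x] unfolding card trace_F3_def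
    by (simp only: sum.lessThan_Suc add_diff_cancel_right')
  finally have "?t * (?t - 1) * (?t + 1) = 0"
    by (simp add: algebra_simps power3_eq_cube)
  then show ?thesis
    by (auto simp: eq_neg_iff_add_eq_0)
qed

end

(*
  Substituting x = gamma X turns the curve into X^3 - X = delta y^2 - c with delta = gamma^-3 and
  c = b gamma^-3.  The map X |-> X^3 - X is 3-to-1 onto the kernel of the trace, so
  #E = 1 + 3 M(Tr c), where M(t) is the number of y with Tr(delta y^2) = t.  Let i^2 = -1; scaling
  by i shows M(1) = M(-1), and w^2 + v^2 = (w + i v)(w - i v) allows one to count the zeros of
  Tr(delta (w^2 + v^2)), which gives (M(0) - M(1))^2 = q.
  The sign is found modulo 4.  The substitutions X |-> -X, 1/X, -1/X act freely on the X for which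
  X^3 - X = delta y^2 has a solution y <> 0: a fixed point outside the prime field satisfies
  X^2 = -1, and then delta would be a square.  Hence 3 M(0) = 3 + 2 * (multiple of 4), which forces
  M(0) - M(1) = (-3)^(d/2).
*)
theory Submission
  imports Defs "HOL-Computational_Algebra.Polynomial"
begin

section \<open>Counting by fibres and by orbits\<close>

text \<open>The fibre sizes add up to \<open>m * card B\<close> and none exceeds \<open>m\<close>,
  so the deficits sum to zero and each of them vanishes.\<close>

lemma card_fibres_eq_bound:
  assumes fin: "finite A" "finite B" and sub: "f ` A \<subseteq> B"
    and le: "\<And>b. b \<in> B \<Longrightarrow> card {a \<in> A. f a = b} \<le> m"
    and card: "card A = m * card B" and b: "b \<in> B"
  shows "card {a \<in> A. f a = b} = m"
proof -
  have "(\<Sum>b\<in>B. card {a \<in> A. f a = b}) = (\<Sum>b\<in>B. m)"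
    using sum.group[OF fin sub, of "\<lambda>_. 1 :: nat"] card by (simp add: mult.commute)
  then have "(\<Sum>b\<in>B. m - card {a \<in> A. f a = b}) = 0"
    using le by (simp add: sum_subtractf_nat)
  then show ?thesis
    using b le[OF b] fin by (simp add: le_antisym)
qed

text \<open>Negation and inversion generate a Klein four-group acting on \<open>A\<close>; by
  \<open>free\<close> only the identity has fixed points, so every orbit has four elements.\<close>

lemma four_dvd_card_signed_inverses:
  fixes A :: "'a::finite_field set"
  assumes uminus: "\<And>x. x \<in> A \<Longrightarrow> - x \<in> A" and inverse: "\<And>x. x \<in> A \<Longrightarrow> inverse x \<in> A"
    and free: "\<And>x. x \<in> A \<Longrightarrow> x \<noteq> - x \<and> x \<noteq> inverse x \<and> x \<noteq> - inverse x"
  shows "4 dvd card A"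
proof (rule equiv_imp_dvd_card)
  define r where "r = {(x, y). x \<in> A \<and> y \<in> {x, - x, inverse x, - inverse x}}"
  show "equiv A r"
  proof (rule equivI)
    show "refl_on A r" by (auto simp: r_def refl_on_def)
    show "sym r" unfolding sym_def r_def
      using uminus inverse by auto
    show "trans r" unfolding trans_def r_def by auto
    show "r \<subseteq> A \<times> A" unfolding r_def
      using uminus inverse by auto
  qed
  fix X assume "X \<in> A // r"
  then obtain x where x: "x \<in> A" "X = {x, - x, inverse x, - inverse x}"
    by (auto simp: quotient_def r_def)
  have "card X = 4"
    using free[OF x(1)] free[OF inverse[OF x(1)]] unfolding x(2)
    by (auto simp: card_insert_if minus_equation_iff)
  then show "4 dvd card X" by simp
qed simp

section \<open>The trace in characteristic 3\<close>

context
  fixes d :: nat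
  assumes card: "card (UNIV :: 'a::finite_field set) = 3 ^ d"
begin

lemma three_eq_0: "(3 :: 'a) = 0"
  using of_nat_CHAR[where 'a = 'a] CHAR_eq_3[OF card] by simp

lemma three_mult_eq_0: "3 * x = (0 :: 'a)"
  by (simp add: three_eq_0)

lemma one_ne_minus_one: "(1 :: 'a) \<noteq> - 1"
proof
  assume "(1 :: 'a) = - 1"
  then have "3 - (1 :: 'a) = 0" by (simp add: eq_neg_iff_add_eq_0)
  then show False by (simp add: three_eq_0)
qed

lemma degree_pos: "d > 0"
proof (rule ccontr)
  assume "\<not> d > 0"
  then have "card (UNIV :: 'a set) = 1" using card by simp
  then obtain z where "(UNIV :: 'a set) = {z}" by (auto simp: card_1_singleton_iff)
  then show False by (metis UNIV_I singletonD zero_neq_one)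
qed

lemma trace_add: "trace_F3 d (x + y :: 'a) = trace_F3 d x + trace_F3 d y"
proof -
  have "(x + y) ^ 3 ^ i = x ^ 3 ^ i + y ^ 3 ^ i" for i
    by (rule freshmans_dream'[where n = i]) (simp_all add: CHAR_eq_3[OF card])
  then show ?thesis by (simp add: trace_F3_def sum.distrib)
qed

lemma trace_0: "trace_F3 d (0 :: 'a) = 0"
  by (simp add: trace_F3_def power_0_left)

lemma trace_minus: "trace_F3 d (- x :: 'a) = - trace_F3 d x"
  using trace_add[of x "- x"] by (simp add: trace_0 eq_neg_iff_add_eq_0 add.commute)

lemma trace_diff: "trace_F3 d (x - y :: 'a) = trace_F3 d x - trace_F3 d y"
  using trace_add[of x "- y"] by (simp add: trace_minus)

text \<open>Frobenius permutes the conjugates cyclically, the cycle being closed by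
  \<open>x ^ 3 ^ d = x\<close>. Hence every value of \<open>x ^ 3 - x\<close> has trace 0.\<close>

lemma trace_cube: "trace_F3 d (x ^ 3 :: 'a) = trace_F3 d x"
proof -
  have "trace_F3 d (x ^ 3) = (\<Sum>i<d. x ^ 3 ^ Suc i)"
    by (simp add: trace_F3_def flip: power_mult)
  also have "\<dots> = (\<Sum>i<Suc d. x ^ 3 ^ i) - x"
    by (subst sum.lessThan_Suc_shift) simp
  also have "\<dots> = trace_F3 d x"
    using finite_field_power_card_eq_same[of x] by (simp add: card trace_F3_def)
  finally show ?thesis .
qed

section \<open>Fibres of the trace and of the Artin-Schreier map\<close>

text \<open>The trace is a polynomial of degree \<open>3 ^ (d - 1)\<close>, which bounds each fibre;
  three values must absorb \<open>3 ^ d\<close> elements, so every bound is attained.\<close>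

lemma card_trace_fibre:
  assumes "c \<in> {0, 1, - 1 :: 'a}"
  shows "card {x :: 'a. trace_F3 d x = c} = 3 ^ (d - 1)"
proof -
  have le: "card {x \<in> UNIV. trace_F3 d x = b} \<le> 3 ^ (d - 1)" for b :: 'a
  proof -
    define p where "p = (\<Sum>i<d. Polynomial.monom (1 :: 'a) (3 ^ i)) - Polynomial.monom b 0"
    have "Polynomial.coeff p (3 ^ (d - 1)) = 1"
      using degree_pos by (simp add: p_def Polynomial.coeff_sum)
    then have "p \<noteq> 0" by auto
    have "Polynomial.degree p \<le> 3 ^ (d - 1)"
      unfolding p_def
      by (intro degree_diff_le degree_sum_le order_trans[OF Polynomial.degree_monom_le]) auto
    moreover have "{x \<in> UNIV. trace_F3 d x = b} = {x. poly p x = 0}"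
      by (simp add: p_def poly_sum poly_monom trace_F3_def)
    ultimately show ?thesis
      using card_poly_roots_bound[OF \<open>p \<noteq> 0\<close>] by simp
  qed
  have "card {x \<in> UNIV. trace_F3 d x = c} = 3 ^ (d - 1)"
  proof (rule card_fibres_eq_bound[where B = "{0, 1, - 1}"])
    have "card {0, 1, - 1 :: 'a} = 3"
      using one_ne_minus_one by (simp add: card_insert_if)
    then show "card (UNIV :: 'a set) = 3 ^ (d - 1) * card {0, 1, - 1 :: 'a}"
      using degree_pos card by (simp flip: power_Suc2)
  qed (use le trace_F3_in_prime_field[OF card] assms in auto)
  then show ?thesis by simp
qed

text \<open>Additive Hilbert 90 by counting: the image lies in the kernel of the trace, which has a
  third of the elements of the field, and a cubic has at most three roots, so every fibre over the
  kernel has exactly three.\<close>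

lemma card_artin_schreier_fibre:
  fixes w :: 'a
  shows "card {x. x ^ 3 - x = w} = (if trace_F3 d w = 0 then 3 else 0)"
proof (cases "trace_F3 d w = 0")
  case True
  have le: "card {x \<in> UNIV. x ^ 3 - x = b} \<le> 3" for b :: 'a
  proof -
    define p where "p = Polynomial.monom 1 3 - Polynomial.monom 1 1 - Polynomial.monom b 0"
    have "Polynomial.coeff p 3 = 1" by (simp add: p_def)
    then have "p \<noteq> 0" by auto
    have "Polynomial.degree p \<le> 3"
      unfolding p_def
      by (intro degree_diff_le order_trans[OF Polynomial.degree_monom_le]) auto
    moreover have "{x \<in> UNIV. x ^ 3 - x = b} = {x. poly p x = 0}"
      by (auto simp: p_def poly_monom algebra_simps)
    ultimately show ?thesis
      using card_poly_roots_bound[OF \<open>p \<noteq> 0\<close>] by simp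
  qed
  have "card {x \<in> UNIV. x ^ 3 - x = w} = 3"
  proof (rule card_fibres_eq_bound[where B = "{x. trace_F3 d x = 0}"])
    show "card (UNIV :: 'a set) = 3 * card {x :: 'a. trace_F3 d x = 0}"
      using degree_pos by (simp add: card_trace_fibre card flip: power_Suc)
  qed (use le True in \<open>auto simp: trace_diff trace_cube\<close>)
  then show ?thesis using True by simp
next
  case False
  then have "{x. x ^ 3 - x = w} = {}" by (auto simp: trace_diff trace_cube)
  then show ?thesis using False by (metis card.empty)
qed

section \<open>A square root of -1 and the distribution of the traces of
  \<open>\<delta> * y ^ 2\<close>\<close>

text \<open>As d is even, 4 divides 3^d - 1 = 4n. The polynomial X^(2n) - 1 cannot vanish at all 4n
  nonzero elements; where it does not, x^(2n) = -1, and x^n is the root sought.\<close>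

lemma sqrt_minus_one_exists:
  assumes "even d"
  shows "\<exists>i :: 'a. i ^ 2 = - 1"
proof -
  obtain k where "d = 2 * k" using assms by (elim evenE)
  then have "(3 :: nat) ^ d mod 4 = 1"
    using power_mod[of 9 "4 :: nat" k] by (simp add: power_mult)
  then obtain n where n: "(3 :: nat) ^ d = 4 * n + 1"
    by (metis mult_div_mod_eq)
  have "n > 0" using n degree_pos by (cases n) auto
  define p where "p = Polynomial.monom (1 :: 'a) (2 * n) - 1"
  have "Polynomial.coeff p (2 * n) = 1" using \<open>n > 0\<close> by (simp add: p_def)
  then have "p \<noteq> 0" by auto
  have "Polynomial.degree p \<le> 2 * n"
    unfolding p_def by (intro degree_diff_le Polynomial.degree_monom_le) auto
  then have "card {x. poly p x = 0} < card (UNIV - {0 :: 'a})"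
    using card_poly_roots_bound[OF \<open>p \<noteq> 0\<close>] \<open>n > 0\<close> n card by (simp add: card_Diff_singleton)
  then obtain x where x: "x \<noteq> 0" "poly p x \<noteq> 0"
    by (metis (mono_tags, lifting) DiffE UNIV_I card_mono finite insertI1 leD mem_Collect_eq subsetI)
  have "x ^ (4 * n) = 1"
    using finite_field_power_card_eq_same[of x] x(1) unfolding card n by simp
  then have "(x ^ (2 * n) - 1) * (x ^ (2 * n) + 1) = 0"
    by (simp add: algebra_simps flip: power_add)
  then have "(x ^ n) ^ 2 = - 1"
    using x(2) by (simp add: p_def poly_monom eq_neg_iff_add_eq_0 flip: power_mult) (simp add: mult.commute)
  then show ?thesis ..
qed

lemma trace_imaginary_multiple:
  fixes i :: 'a
  assumes "i ^ 2 = - 1"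
  shows "trace_F3 d (\<delta> * (i * y) ^ 2) = - trace_F3 d (\<delta> * y ^ 2)"
  using assms by (simp add: power_mult_distrib trace_minus)

lemma card_quadratic_trace_minus_one:
  fixes i \<delta> :: 'a
  assumes i: "i ^ 2 = - 1"
  shows "card {y. trace_F3 d (\<delta> * y ^ 2) = - 1} = card {y. trace_F3 d (\<delta> * y ^ 2) = 1}"
proof (rule bij_betw_same_card)
  have "i * (i * y) = - y" for y
    using i by (simp add: power2_eq_square flip: mult.assoc)
  then show "bij_betw ((*) i) {y. trace_F3 d (\<delta> * y ^ 2) = - 1}
      {y. trace_F3 d (\<delta> * y ^ 2) = 1}"
    by (intro bij_betw_byWitness[where f' = "\<lambda>y. - (i * y)"])
      (auto simp: trace_imaginary_multiple[OF i])
qed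

text \<open>Used with the constant weight 1 to count the field, and with fibre sizes as weights to
  count pairs.\<close>

lemma sum_by_trace:
  fixes g :: "'a \<Rightarrow> 'a" and h :: "'a \<Rightarrow> nat"
  shows "(\<Sum>x\<in>UNIV. h (trace_F3 d (g x))) =
    card {x. trace_F3 d (g x) = 0} * h 0 + card {x. trace_F3 d (g x) = 1} * h 1 +
    card {x. trace_F3 d (g x) = - 1} * h (- 1)"
proof -
  have "(\<Sum>x\<in>UNIV. h (trace_F3 d (g x))) =
      (\<Sum>c\<in>{0, 1, - 1}. \<Sum>x | x \<in> UNIV \<and> trace_F3 d (g x) = c. h (trace_F3 d (g x)))"
    by (rule sum.group[symmetric]) (use trace_F3_in_prime_field[OF card] in auto)
  also have "\<dots> = (\<Sum>c\<in>{0, 1, - 1}. card {x. trace_F3 d (g x) = c} * h c)"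
    by (intro sum.cong) auto
  finally show ?thesis
    using one_ne_minus_one by simp
qed

lemma card_quadratic_trace_sum:
  fixes i \<delta> :: 'a
  assumes "i ^ 2 = - 1"
  shows "card {y. trace_F3 d (\<delta> * y ^ 2) = 0} + 2 * card {y. trace_F3 d (\<delta> * y ^ 2) = 1} = 3 ^ d"
  using sum_by_trace[of "\<lambda>_. 1" "\<lambda>y. \<delta> * y ^ 2"] card_quadratic_trace_minus_one[OF assms, of \<delta>]
  by (simp add: card)

text \<open>Both sides count the zeros of \<open>trace_F3 d (\<delta> * (w ^ 2 + v ^ 2))\<close>.
  Grouping by the trace of \<open>\<delta> * w ^ 2\<close> gives the left side. In the coordinates
  s, t with w^2 + v^2 = s t, s = 0 contributes the whole field and each other s a copy of the kernel
  of the trace.\<close>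

lemma card_quadratic_trace_square_sum:
  fixes i \<delta> :: 'a
  assumes i: "i ^ 2 = - 1" and \<delta>: "\<delta> \<noteq> 0"
  shows "card {y. trace_F3 d (\<delta> * y ^ 2) = 0} ^ 2 + 2 * card {y. trace_F3 d (\<delta> * y ^ 2) = 1} ^ 2 =
    3 ^ d + (3 ^ d - 1) * 3 ^ (d - 1)"
proof -
  define M where "M c = card {y. trace_F3 d (\<delta> * y ^ 2) = c}" for c
  have ii: "i * (i * y) = - y" for y
    using i by (simp add: power2_eq_square flip: mult.assoc)
  have norm: "w ^ 2 + v ^ 2 = (w + i * v) * (w - i * v)" for w v
    using ii[of "v * v"] by (simp add: algebra_simps power2_eq_square)
  have minus_two: "- x - x = x" for x :: 'a
    using three_mult_eq_0[of x] by (simp add: algebra_simps)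
  \<comment> \<open>Since 2 = -1 here, w = (s + t)/2 becomes -(s + t), and v = (s - t)/(2i) becomes
    i(s - t).\<close>
  define f g where "f = (\<lambda>(w, v). (w + i * v, w - i * v))"
    and "g = (\<lambda>(s, t). (- (s + t), i * (s - t)))"
  have gf: "g (f p) = p" and fg: "f (g p) = p" for p
    using minus_two[of "fst p"] minus_two[of "snd p"]
    by (simp_all add: f_def g_def ii split_beta prod_eq_iff algebra_simps)
  have "bij_betw f {(w, v). trace_F3 d (\<delta> * (w ^ 2 + v ^ 2)) = 0} {(s, t). trace_F3 d (\<delta> * (s * t)) = 0}"
  proof (rule bij_betw_byWitness[where f' = g])
    show "g ` {(s, t). trace_F3 d (\<delta> * (s * t)) = 0} \<subseteq> {(w, v). trace_F3 d (\<delta> * (w ^ 2 + v ^ 2)) = 0}"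
    proof
      fix p assume "p \<in> g ` {(s, t). trace_F3 d (\<delta> * (s * t)) = 0}"
      then have "f p \<in> {(s, t). trace_F3 d (\<delta> * (s * t)) = 0}" by (auto simp: fg)
      then show "p \<in> {(w, v). trace_F3 d (\<delta> * (w ^ 2 + v ^ 2)) = 0}"
        by (auto simp: f_def norm)
    qed
  qed (auto simp: gf fg, auto simp: f_def norm)
  then have "card {(w, v). trace_F3 d (\<delta> * (w ^ 2 + v ^ 2)) = 0} =
      card {(s, t). trace_F3 d (\<delta> * (s * t)) = 0}"
    by (rule bij_betw_same_card)
  \<comment> \<open>For fixed w, additivity prescribes the trace of \<open>\<delta> * v ^ 2\<close>,
    so the fibre over w is a level set counted by \<open>M\<close>.\<close>
  moreover have "{(w, v). trace_F3 d (\<delta> * (w ^ 2 + v ^ 2)) = 0} =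
      (SIGMA w : UNIV. {v. trace_F3 d (\<delta> * v ^ 2) = - trace_F3 d (\<delta> * w ^ 2)})"
    by (auto simp: distrib_left trace_add eq_neg_iff_add_eq_0 add.commute)
  then have "card {(w, v). trace_F3 d (\<delta> * (w ^ 2 + v ^ 2)) = 0} =
      (\<Sum>w\<in>UNIV. M (- trace_F3 d (\<delta> * w ^ 2)))"
    by (simp add: M_def)
  then have "card {(w, v). trace_F3 d (\<delta> * (w ^ 2 + v ^ 2)) = 0} = M 0 ^ 2 + 2 * M 1 ^ 2"
    using card_quadratic_trace_minus_one[OF i, of \<delta>]
      sum_by_trace[of "\<lambda>c. M (- c)" "\<lambda>w. \<delta> * w ^ 2"]
    by (simp add: M_def flip: power2_eq_square)
  moreover have "card {(s, t). trace_F3 d (\<delta> * (s * t)) = 0} = 3 ^ d + (3 ^ d - 1) * 3 ^ (d - 1)"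
  proof -
    have fibre: "card {t. trace_F3 d (\<delta> * (s * t)) = 0} = 3 ^ (d - 1)" if "s \<noteq> 0" for s
    proof -
      have "bij_betw ((*) (\<delta> * s)) {t. trace_F3 d (\<delta> * (s * t)) = 0} {t. trace_F3 d t = 0}"
        using \<delta> that by (intro bij_betw_byWitness[where f' = "\<lambda>t. t / (\<delta> * s)"]) (auto simp: mult.assoc)
      then show ?thesis
        using bij_betw_same_card card_trace_fibre[of 0] by fastforce
    qed
    have "{(s, t). trace_F3 d (\<delta> * (s * t)) = 0} = (SIGMA s : UNIV. {t. trace_F3 d (\<delta> * (s * t)) = 0})"
      by auto
    then have "card {(s, t). trace_F3 d (\<delta> * (s * t)) = 0} =
        (\<Sum>s\<in>UNIV. card {t. trace_F3 d (\<delta> * (s * t)) = 0})"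
      by simp
    also have "\<dots> = card {t. trace_F3 d (\<delta> * (0 * t)) = 0} +
        (\<Sum>s\<in>UNIV - {0}. card {t. trace_F3 d (\<delta> * (s * t)) = 0})"
      by (rule sum.remove) auto
    also have "(\<Sum>s\<in>UNIV - {0}. card {t. trace_F3 d (\<delta> * (s * t)) = 0}) = (3 ^ d - 1) * 3 ^ (d - 1)"
      by (simp add: fibre card_Diff_singleton card)
    finally show ?thesis by (simp add: card trace_0)
  qed
  ultimately show ?thesis by (simp add: M_def)
qed

lemma card_quadratic_trace_diff_square:
  fixes i \<delta> :: 'a
  assumes "i ^ 2 = - 1" and "\<delta> \<noteq> 0"
  shows "(int (card {y. trace_F3 d (\<delta> * y ^ 2) = 0}) - int (card {y. trace_F3 d (\<delta> * y ^ 2) = 1})) ^ 2 = 3 ^ d"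
proof -
  define m0 m1 Q where "m0 = int (card {y. trace_F3 d (\<delta> * y ^ 2) = 0})"
    and "m1 = int (card {y. trace_F3 d (\<delta> * y ^ 2) = 1})" and "Q = (3 :: int) ^ (d - 1)"
  have Q: "3 ^ d = 3 * Q"
    using degree_pos by (simp add: Q_def flip: power_Suc)
  have "m0 + 2 * m1 = 3 ^ d"
    using arg_cong[OF card_quadratic_trace_sum[OF assms(1), of \<delta>], of int] by (simp add: m0_def m1_def)
  then have m0: "m0 = 3 * Q - 2 * m1" by (simp add: Q)
  have "m0 ^ 2 + 2 * m1 ^ 2 = 3 ^ d + (3 ^ d - 1) * Q"
    using arg_cong[OF card_quadratic_trace_square_sum[OF assms], of int]
    by (simp add: m0_def m1_def Q_def of_nat_diff)
  then have "6 * (Q - m1) ^ 2 = 2 * Q"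
    unfolding m0 Q by (simp add: algebra_simps power2_eq_square)
  \<comment> \<open>Eliminating \<open>m0\<close> also gives m0 - m1 = 3(Q - m1), so the previous
    identity is multiplied by 3/2.\<close>
  then have "(m0 - m1) ^ 2 = 3 * Q"
    unfolding m0 by (simp add: algebra_simps power2_eq_square)
  then show ?thesis by (simp add: m0_def m1_def Q)
qed

section \<open>The sign of the difference, by counting modulo 8\<close>

text \<open>For each y there are three solutions x or none, according to the trace of the right-hand
  side. The case \<open>w = 0\<close> serves the sign, the general case the curve.\<close>

lemma card_twisted_artin_schreier:
  fixes \<delta> w :: 'a
  shows "(\<Sum>y\<in>UNIV. card {x. x ^ 3 - x = \<delta> * y ^ 2 - w}) =
    3 * card {y. trace_F3 d (\<delta> * y ^ 2) = trace_F3 d w}"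
proof -
  have "(\<Sum>y\<in>UNIV. card {x. x ^ 3 - x = \<delta> * y ^ 2 - w}) =
      (\<Sum>y\<in>UNIV. if trace_F3 d (\<delta> * y ^ 2) = trace_F3 d w then 3 else 0)"
    by (simp add: card_artin_schreier_fibre trace_diff)
  then show ?thesis by (simp flip: sum.inter_filter)
qed

text \<open>The points of x^3 - x = \<delta> y^2 are counted twice. Over y they number three times
  the count in question; over x there are three with y = 0 and two above each element of
  \<open>N\<close>, whose size is divisible by 4.\<close>

lemma card_quadratic_trace_zero_mod_8:
  fixes i \<delta> :: 'a
  assumes i: "i ^ 2 = - 1" and \<delta>: "\<delta> \<noteq> 0" "\<And>z. \<delta> \<noteq> z ^ 2"
  shows "3 * card {y. trace_F3 d (\<delta> * y ^ 2) = 0} mod 8 = 3"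
proof -
  define N where "N = {x. \<exists>y. y \<noteq> 0 \<and> x ^ 3 - x = \<delta> * y ^ 2}"
  have prime_field: "x ^ 3 - x = 0 \<longleftrightarrow> x \<in> {0, 1, - 1}" for x :: 'a
  proof -
    have "x ^ 3 - x = x * (x - 1) * (x + 1)"
      by (simp add: algebra_simps power3_eq_cube)
    then show ?thesis by (auto simp: eq_neg_iff_add_eq_0)
  qed
  \<comment> \<open>Above an element of the prime field lies only y = 0; above an element of
    \<open>N\<close> lie the two distinct points z and -z.\<close>
  have fibre: "card {y. x ^ 3 - x = \<delta> * y ^ 2} = of_bool (x \<in> {0, 1, - 1}) + 2 * of_bool (x \<in> N)" for x
  proof (cases "x \<in> N")
    case True
    then obtain z where z: "z \<noteq> 0" "x ^ 3 - x = \<delta> * z ^ 2" by (auto simp: N_def)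
    then have "x \<notin> {0, 1, - 1}" using \<delta> prime_field by auto
    moreover have "{y. x ^ 3 - x = \<delta> * y ^ 2} = {z, - z}"
      using z(2) \<delta>(1) by (auto simp: power2_eq_iff)
    moreover have "z \<noteq> - z"
      using z(1) one_ne_minus_one by (metis mult_cancel_left1 mult_minus_right)
    ultimately show ?thesis using True by simp
  next
    case False
    then have "y = 0" if "x ^ 3 - x = \<delta> * y ^ 2" for y
      using that by (auto simp: N_def)
    then have *: "{y. x ^ 3 - x = \<delta> * y ^ 2} = (if x \<in> {0, 1, - 1} then {0} else {})"
    proof (cases "x \<in> {0, 1, - 1}")
      case True
      then have "x ^ 3 - x = 0" by (simp only: prime_field)
      then show ?thesis using True \<delta>(1) by simp
    next
      case no_root: False
      then have "x ^ 3 - x \<noteq> 0" by (simp only: prime_field not_False_eq_True)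
      have "x ^ 3 - x \<noteq> \<delta> * y ^ 2" for y
      proof
        assume *: "x ^ 3 - x = \<delta> * y ^ 2"
        then have "y = 0" by fact
        with * \<open>x ^ 3 - x \<noteq> 0\<close> show False by simp
      qed
      then show ?thesis using no_root by (simp only: if_False Collect_empty_eq simp_thms)
    qed
    show ?thesis using False unfolding * by simp
  qed
  have "3 * card {y. trace_F3 d (\<delta> * y ^ 2) = 0} = (\<Sum>y\<in>UNIV. card {x. x ^ 3 - x = \<delta> * y ^ 2})"
    using card_twisted_artin_schreier[of \<delta> 0] by (simp add: trace_0)
  also have "\<dots> = (\<Sum>x\<in>UNIV. card {y. x ^ 3 - x = \<delta> * y ^ 2})"
    using sum_multicount_gen[of UNIV UNIV "\<lambda>y x. x ^ 3 - x = \<delta> * y ^ 2"] by simp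
  also have "\<dots> = card {0, 1, - 1 :: 'a} + 2 * card N"
    unfolding fibre sum.distrib by (simp del: insert_iff flip: sum_distrib_left)
  also have "card {0, 1, - 1 :: 'a} = 3"
    using one_ne_minus_one by simp
  finally have "3 * card {y. trace_F3 d (\<delta> * y ^ 2) = 0} = 3 + 2 * card N" .
  moreover have "4 dvd card N"
  proof (rule four_dvd_card_signed_inverses)
    fix x assume "x \<in> N"
    then obtain y where y: "y \<noteq> 0" "x ^ 3 - x = \<delta> * y ^ 2" by (auto simp: N_def)
    then have "x \<notin> {0, 1, - 1}" using \<delta>(1) prime_field by auto
    then have x: "x \<noteq> 0" "x \<noteq> 1" "x \<noteq> - 1" by auto
    have "i \<noteq> 0" using i by auto
    have "(- x) ^ 3 - (- x) = \<delta> * (i * y) ^ 2"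
      using y(2) i by (simp add: power_mult_distrib algebra_simps)
    then show "- x \<in> N" using y(1) \<open>i \<noteq> 0\<close> unfolding N_def by (intro CollectI exI[of _ "i * y"]) simp
    \<comment> \<open>Inversion changes x^3 - x by the factor -1/x^4, which is the square of
      i/x^2.\<close>
    have "inverse x ^ 3 - inverse x = - (x ^ 3 - x) / x ^ 4"
      using x(1) by (simp add: field_simps eval_nat_numeral)
    also have "\<dots> = \<delta> * (i * y / x ^ 2) ^ 2"
      using i by (simp add: y(2) power_mult_distrib power_divide flip: power_mult)
    finally show "inverse x \<in> N"
      using y(1) \<open>i \<noteq> 0\<close> x(1) unfolding N_def by (intro CollectI exI[of _ "i * y / x ^ 2"]) simp
    have "x \<noteq> - x"
      using x(1) one_ne_minus_one by (metis mult_cancel_left1 mult_minus_right)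
    moreover have "x \<noteq> inverse x"
      using x by (metis power2_eq_1_iff power2_eq_square right_inverse)
    moreover have "x \<noteq> - inverse x"
    proof
      assume "x = - inverse x"
      then have "x * x = - 1" using x(1) by (metis mult_minus_right right_inverse)
      then have "x * (x * z) = - z" for z by (simp flip: mult.assoc)
      \<comment> \<open>From x^2 = -1 follows (1 + x)^2 = 2x, so both expressions equal -2x. Thus
        \<delta> y^2 would be a square, and \<delta> with it.\<close>
      then have "(x * (1 + x)) ^ 2 = x - 3 * x" and "x ^ 3 - x = x - 3 * x"
        using \<open>x * x = - 1\<close> by (simp_all add: algebra_simps power2_eq_square power3_eq_cube)
      then have "\<delta> * y ^ 2 = (x * (1 + x)) ^ 2" using y(2) by simp
      then have "\<delta> = (x * (1 + x) / y) ^ 2" using y(1) by (simp add: field_simps)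
      then show False using \<delta>(2) by blast
    qed
    ultimately show "x \<noteq> - x \<and> x \<noteq> inverse x \<and> x \<noteq> - inverse x" by blast
  qed
  ultimately show ?thesis by (elim dvdE) simp
qed

lemma card_quadratic_trace_diff:
  fixes \<delta> :: 'a
  assumes "even d" and \<delta>: "\<delta> \<noteq> 0" "\<And>z. \<delta> \<noteq> z ^ 2"
  shows "int (card {y. trace_F3 d (\<delta> * y ^ 2) = 0}) - int (card {y. trace_F3 d (\<delta> * y ^ 2) = 1}) =
    (- 3) ^ (d div 2)"
proof -
  obtain i :: 'a where i: "i ^ 2 = - 1" using sqrt_minus_one_exists[OF \<open>even d\<close>] ..
  define k where "k = d div 2"
  have d: "d = 2 * k" using \<open>even d\<close> by (simp add: k_def)
  define m0 m1 where "m0 = int (card {y. trace_F3 d (\<delta> * y ^ 2) = 0})"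
    and "m1 = int (card {y. trace_F3 d (\<delta> * y ^ 2) = 1})"
  \<comment> \<open>The root is written as a power of -3, not of 3, because it is then 1 modulo 4
    for every k.\<close>
  have "(m0 - m1) ^ 2 = ((- 3) ^ k) ^ 2"
    using card_quadratic_trace_diff_square[OF i \<delta>(1)]
    by (simp add: m0_def m1_def d power_mult flip: power_mult_distrib power2_eq_square)
      (simp add: power2_eq_square flip: power_mult_distrib)
  then have cases: "m0 - m1 = (- 3) ^ k \<or> m0 - m1 = - ((- 3) ^ k)"
    by (simp add: power2_eq_iff)
  have "m0 + 2 * m1 = 3 ^ d"
    using arg_cong[OF card_quadratic_trace_sum[OF i, of \<delta>], of int] by (simp add: m0_def m1_def)
  moreover have "(3 :: int) ^ d mod 8 = 1"
    using power_mod[of 9 "8 :: int" k] by (simp add: d power_mult)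
  moreover have "3 * m0 mod 8 = 3"
    using arg_cong[OF card_quadratic_trace_zero_mod_8[OF i \<delta>], of int]
    by (simp add: m0_def zmod_int)
  moreover have "(- 3 :: int) ^ k mod 4 = 1"
    using power_mod[of "- 3" "4 :: int" k] by simp
  \<comment> \<open>From 3 m0 = 3 and m0 + 2 m1 = 1 modulo 8 follow m0 = 1 modulo 8 and m1 = 0
    modulo 4, so m0 - m1 = 1 modulo 4, whereas the negative root is -1.\<close>
  ultimately have "m0 - m1 \<noteq> - ((- 3) ^ k)" by presburger
  then show ?thesis using cases by (simp add: m0_def m1_def k_def)
qed

section \<open>From the curve to the trace counts\<close>

text \<open>Putting \<gamma> x for x turns the cubic into \<gamma>^3 (x^3 - x) + b; after division
  by \<gamma>^3 the affine points with a given y form an Artin-Schreier fibre. The summand 1 is the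
  point at infinity.\<close>

lemma card_weierstrass_points:
  fixes a4 b \<gamma> :: 'a
  assumes gamma: "\<gamma> \<noteq> 0" "- a4 = \<gamma> ^ 2"
  shows "card (weierstrass_points a4 b) =
    1 + 3 * card {y. trace_F3 d (inverse (\<gamma> ^ 3) * y ^ 2) = trace_F3 d (b * inverse (\<gamma> ^ 3))}"
proof -
  define \<delta> where "\<delta> = inverse (\<gamma> ^ 3)"
  have a4: "a4 = - (\<gamma> ^ 2)" using gamma(2) by (metis minus_minus)
  have eq: "y ^ 2 = (\<gamma> * x) ^ 3 + a4 * (\<gamma> * x) + b \<longleftrightarrow> x ^ 3 - x = \<delta> * y ^ 2 - b * \<delta>" for x y
  proof -
    have "(\<gamma> * x) ^ 3 + a4 * (\<gamma> * x) = \<gamma> ^ 3 * (x ^ 3 - x)"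
      by (simp add: a4 algebra_simps eval_nat_numeral)
    then show ?thesis using gamma(1) by (auto simp: \<delta>_def right_diff_distrib divide_simps mult.commute)
  qed
  have fibre: "card {x. y ^ 2 = x ^ 3 + a4 * x + b} = card {x. x ^ 3 - x = \<delta> * y ^ 2 - b * \<delta>}" for y
  proof -
    have "bij_betw ((*) \<gamma>) {x. x ^ 3 - x = \<delta> * y ^ 2 - b * \<delta>} {x. y ^ 2 = x ^ 3 + a4 * x + b}"
      using gamma(1) by (intro bij_betw_byWitness[where f' = "\<lambda>x. x / \<gamma>"]) (auto simp flip: eq)
    then show ?thesis by (rule bij_betw_same_card[symmetric])
  qed
  \<comment> \<open>The coordinates are swapped so that the sum runs over y.\<close>
  have "weierstrass_points a4 b =
      insert Infinity ((\<lambda>(y, x). Affine x y) ` (SIGMA y : UNIV. {x. y ^ 2 = x ^ 3 + a4 * x + b}))"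
    by (auto simp: weierstrass_points_def)
  moreover have "inj_on (\<lambda>(y, x). Affine x y) S" for S :: "('a \<times> 'a) set"
    by (auto simp: inj_on_def)
  ultimately have "card (weierstrass_points a4 b) =
      Suc (\<Sum>y\<in>UNIV. card {x. y ^ 2 = x ^ 3 + a4 * x + b})"
    by (subst (asm) insert_is_Un) (auto simp: card_insert_if card_image)
  also have "\<dots> = 1 + 3 * card {y. trace_F3 d (\<delta> * y ^ 2) = trace_F3 d (b * \<delta>)}"
    by (simp add: fibre card_twisted_artin_schreier)
  finally show ?thesis by (simp add: \<delta>_def)
qed

end

theorem proposition3p4:
  fixes a4 b \<gamma> :: "'a::finite_field" and q d :: nat
  assumes q: "q = 3 ^ d" and card: "card (UNIV :: 'a set) = q"
    and d: "even d"
    and ell: "is_elliptic_curve a4 b"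
    and gamma: "\<gamma> \<noteq> 0" "- a4 = \<gamma> ^ 2"
    and nonsquare: "\<not> (\<exists>z. z \<noteq> 0 \<and> \<gamma> = z ^ 2)"
  shows "(trace_F3 d (b * \<gamma> powi (-3)) = 0 \<longrightarrow>
            real (card (weierstrass_points a4 b)) =
              real q + 1 + (-1) ^ (d div 2) * 2 * sqrt (real q)) \<and>
         (trace_F3 d (b * \<gamma> powi (-3)) = 1 \<or> trace_F3 d (b * \<gamma> powi (-3)) = -1 \<longrightarrow>
            real (card (weierstrass_points a4 b)) =
              real q + 1 - (-1) ^ (d div 2) * sqrt (real q))"
proof -
  have card': "card (UNIV :: 'a set) = 3 ^ d" using q card by simp
  obtain i :: 'a where i: "i ^ 2 = - 1" using sqrt_minus_one_exists[OF card' d] ..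
  define \<delta> where "\<delta> = inverse (\<gamma> ^ 3)"
  have "\<gamma> powi (- 3) = \<delta>" by (simp add: \<delta>_def power_int_minus)
  have \<delta>: "\<delta> \<noteq> 0" "\<delta> \<noteq> z ^ 2" for z
  proof -
    show "\<delta> \<noteq> 0" using gamma(1) by (simp add: \<delta>_def)
    show "\<delta> \<noteq> z ^ 2"
    proof
      assume "\<delta> = z ^ 2"
      then have "z \<noteq> 0" using \<open>\<delta> \<noteq> 0\<close> by auto
      have "\<gamma> ^ 3 * z ^ 2 = 1" using gamma(1) by (simp add: \<delta>_def flip: \<open>\<delta> = z ^ 2\<close>)
      \<comment> \<open>As \<gamma>^3 is \<gamma> times a square, a square root z of \<delta> would
        yield the square root 1/(\<gamma> z) of \<gamma>.\<close>
      then have "(\<gamma> * z) ^ 2 * \<gamma> = 1" by (simp add: eval_nat_numeral mult_ac)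
      then have "\<gamma> = inverse (\<gamma> * z) ^ 2" by (metis inverse_unique power_inverse)
      then show False using nonsquare \<open>z \<noteq> 0\<close> gamma(1) by (metis inverse_nonzero_iff_nonzero mult_eq_0_iff)
    qed
  qed
  define M where "M c = card {y. trace_F3 d (\<delta> * y ^ 2) = c}" for c
  have points: "card (weierstrass_points a4 b) = 1 + 3 * M (trace_F3 d (b * \<gamma> powi (- 3)))"
    unfolding \<open>\<gamma> powi (- 3) = \<delta>\<close> unfolding M_def \<delta>_def by (rule card_weierstrass_points[OF card' gamma])
  have "M (- 1) = M 1"
    unfolding M_def by (rule card_quadratic_trace_minus_one[OF card' i])
  have "real (M 0) + 2 * real (M 1) = q"
    using arg_cong[OF card_quadratic_trace_sum[OF card' i, of \<delta>], of real] by (simp add: M_def q)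
  moreover have "real (M 0) - real (M 1) = (- 1) ^ (d div 2) * sqrt q"
  proof -
    have "sqrt q = 3 ^ (d div 2)"
      using d by (auto simp: q real_sqrt_power power_mult elim!: evenE)
    moreover have "real (M 0) - real (M 1) = (- 3) ^ (d div 2)"
      using arg_cong[OF card_quadratic_trace_diff[OF card' d \<delta>], of real_of_int] by (simp add: M_def)
    ultimately show ?thesis by (simp flip: power_mult_distrib)
  qed
  \<comment> \<open>With e = (-1)^(d/2), the two linear relations give 3 M(0) = q + 2 e sqrt q and 3
    M(1) = q - e sqrt q.\<close>
  ultimately show ?thesis
    using \<open>M (- 1) = M 1\<close> by (auto simp: points algebra_simps)
qed

end
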